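(* Let $P$ be a probability distribution on $\mathbb{C}^p$, let $\mathbf{x}\sim P$, and let $\mathbf{x}_1,\dots,\mathbf{x}_m$ be drawn independently from $P$. Let $\mathbf{v}_1,\dots,\mathbf{v}_m\in\mathbb{C}^p$ be noise vectors, independent of each other and of the signals, whose entries are independent zero-mean circularly symmetric complex Gaussians of a common variance $\sigma^2$; the noisy training signals are $\mathbf{z}_j=\mathbf{x}_j+\mathbf{v}_j$. For each feasible sampling pattern $\Omega\in\mathcal{A}$, the acquired signal is $\mathbf{b}=\mathbf{P}_\Omega\boldsymbol{\Psi}\mathbf{x}+\mathbf{w}$, where $\mathbf{w}\in\mathbb{C}^{|\Omega|}$ is independent of $\mathbf{x}$ and has independent zero-mean circularly symmetric complex Gaussian entries of the same variance $\sigma^2$. Let $g$ be an arbitrary decoder, write $\hat{\mathbf{x}}(\mathbf{b})=g(\Omega,\mathbf{b})$, and define $$\overline{\eta}_{\mathrm{noisy}}(\Omega)=\mathbb{E}\left[\eta\big(\mathbf{x},\hat{\mathbf{x}}(\mathbf{P}_\Omega\boldsymbol{\Psi}\mathbf{x}+\mathbf{w})\big)\right].$$ Let $\xi:\mathbb{C}^p\to\mathbb{C}^p$ be a denoiser, and let $\widetilde{\mathbf{v}}_j=\xi(\mathbf{z}_j)-\mathbf{x}_j$ be the effective noise remaining in the $j$-th denoised training signal, where $\mathbb{E}[\|\widetilde{\mathbf{v}}_j\|_2]\le\mathbb{E}[\|\mathbf{v}_j\|_2]$. Let $\widetilde{\mathbf{v}}$ denote a random vector with the same distribution as any given $\widetilde{\mathbf{v}}_j$.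 Suppose that the performance measure satisfies $\eta(\mathbf{x},\hat{\mathbf{x}})\in[0,1]$ and the continuity assumption $|\eta(\mathbf{x},\hat{\mathbf{x}})-\eta(\mathbf{x}',\hat{\mathbf{x}})|\le L\|\mathbf{x}-\mathbf{x}'\|_2$ for all $\mathbf{x},\mathbf{x}',\hat{\mathbf{x}}\in\mathbb{C}^p$ and some $L>0$. Then for any $\delta\in(0,1)$, with probability at least $1-\delta$ (with respect to the randomness of the noisy training signals), it holds that $$\left|\frac{1}{m}\sum_{j=1}^m\eta\big(\mathbf{x}_j+\widetilde{\mathbf{v}}_j,\ \hat{\mathbf{x}}(\mathbf{P}_\Omega\boldsymbol{\Psi}(\mathbf{x}_j+\mathbf{v}_j))\big)-\overline{\eta}_{\mathrm{noisy}}(\Omega)\right|\le L\,\mathbb{E}[\|\widetilde{\mathbf{v}}\|_2]+\sqrt{\frac{1}{2m}\log\left(\frac{2|\mathcal{A}|}{\delta}\right)}$$ simultaneously for all $\Omega\in\mathcal{A}$.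
   Context: $\boldsymbol{\Psi}\in\mathbb{C}^{p\times p}$ is the (unitary) Fourier transform matrix. For $\Omega\subseteq\{1,\dots,p\}$ with $|\Omega|=n$, $\mathbf{P}_\Omega:\mathbb{C}^p\to\mathbb{C}^n$ is the subsampling operator keeping the coordinates indexed by $\Omega$ (so $\mathbf{P}_\Omega\boldsymbol{\Psi}$ consists of the rows of $\boldsymbol{\Psi}$ indexed by $\Omega$). A decoder is an arbitrary (measurable, deterministic) function $g$ that maps a pair $(\Omega,\mathbf{b})$ with $\mathbf{b}\in\mathbb{C}^{|\Omega|}$ to an estimate $\hat{\mathbf{x}}=g(\Omega,\mathbf{b})\in\mathbb{C}^p$. A performance measure is a (measurable) real-valued function $\eta(\mathbf{x},\hat{\mathbf{x}})$ of a signal and its estimate. A denoiser is a (measurable, deterministic) function $\xi:\mathbb{C}^p\to\mathbb{C}^p$. The feasible set $\mathcal{A}$ is a collection of subsets of $\{1,\dots,p\}$ (hence finite), given as follows: there is a set $\mathcal{S}$ of subsets of $\{1,\dots,p\}$, a cost function $c(\Omega)\ge 0$ that is monotone ($\Omega_1\subseteq\Omega_2$ implies $c(\Omega_1)\le c(\Omega_2)$), and a budget $\Gamma>0$; $\mathcal{A}$ consists of all $\Omega=\bigcup_{j=1}^{\ell}S_j$ with $\ell>0$, $S_j\in\mathcal{S}$, and $c(\Omega)\le\Gamma$. The expectation in $\overline{\eta}_{\mathrm{noisy}}(\Omega)$ is over both $\mathbf{x}$ and $\mathbf{w}$; $\log$ is the natural logarithm. *)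

theory Defs
  imports "HOL-Probability.Probability"
begin

text \<open>
  The index set \<open>{1, ..., p}\<close> is a finite linearly ordered type \<open>'p\<close>, with \<open>p = CARD('p)\<close>; the number
  of elements below \<open>i\<close> is the zero-based position of \<open>i\<close>. The norm on \<open>'p cvec\<close> is the
  Euclidean one.
\<close>

type_synonym 'p cvec = "(complex, 'p) vec"

definition fourier_matrix :: "('p cvec, 'p::{finite,linorder}) vec" where
  "fourier_matrix = (\<chi> i k. cis (- 2 * pi * real (card {..<i}) * real (card {..<k}) / real CARD('p))
                              / complex_of_real (sqrt (real CARD('p))))"

text \<open>
  Vectors in \<open>\<complex>\<^bsup>|\<Omega>|\<^esup>\<close> are indexed by the elements of \<open>\<Omega>\<close> itself: they are the elements of
  \<open>\<Omega> \<rightarrow>\<^sub>E UNIV\<close>, the space of \<open>Pi\<^sub>M \<Omega> (\<lambda>_. borel)\<close>.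
\<close>

definition subsample :: "('p::finite) set \<Rightarrow> 'p cvec \<Rightarrow> 'p \<Rightarrow> complex" where
  "subsample \<Omega> y = (\<lambda>i\<in>\<Omega>. y $ i)"

definition noisy_samples ::
  "'p set \<Rightarrow> ('p::{finite,linorder}) cvec \<Rightarrow> ('p \<Rightarrow> complex) \<Rightarrow> 'p \<Rightarrow> complex" where
  "noisy_samples \<Omega> x w = (\<lambda>i\<in>\<Omega>. subsample \<Omega> (fourier_matrix *v x) i + w i)"

definition feasible_patterns :: "'p set set \<Rightarrow> ('p set \<Rightarrow> real) \<Rightarrow> real \<Rightarrow> 'p set set" where
  "feasible_patterns \<S> c \<Gamma> =
     {\<Omega>. (\<exists>l>0. \<exists>S :: nat \<Rightarrow> 'p set. (\<forall>j\<in>{1..l}. S j \<in> \<S>) \<and> \<Omega> = (\<Union>j\<in>{1..l}. S j)) \<and> c \<Omega> \<le> \<Gamma>}"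

text \<open>
  The zero-mean circularly symmetric complex Gaussian law with \<open>E |Z|\<^sup>2 = s\<close>: real and imaginary part
  are independent \<open>N(0, s/2)\<close>. For \<open>s = 0\<close> this is the point mass at 0.
\<close>

definition cscg :: "real \<Rightarrow> complex measure" where
  "cscg s = distr (std_normal_distribution \<Otimes>\<^sub>M std_normal_distribution) borel
              (\<lambda>(a, b). Complex (sqrt (s / 2) * a) (sqrt (s / 2) * b))"

lemma measurable_Complex_scaled:
  "(\<lambda>(a, b). Complex (sqrt (s / 2) * a) (sqrt (s / 2) * b))
     \<in> std_normal_distribution \<Otimes>\<^sub>M std_normal_distribution \<rightarrow>\<^sub>M borel"
proof -
  have "sets (std_normal_distribution \<Otimes>\<^sub>M std_normal_distribution) = sets (borel :: (real \<times> real) measure)"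
    by (simp add: borel_prod[symmetric] cong: sets_pair_measure_cong)
  moreover have "(\<lambda>(a, b). Complex (sqrt (s / 2) * a) (sqrt (s / 2) * b)) \<in> borel_measurable borel"
    by (intro borel_measurable_continuous_onI)
       (auto simp: Complex_eq case_prod_beta intro!: continuous_intros)
  ultimately show ?thesis
    using measurable_cong_sets by blast
qed

lemma prob_space_cscg: "prob_space (cscg s)"
proof -
  interpret N: prob_space std_normal_distribution
    by (rule prob_space_normal_density) simp
  interpret NN: pair_prob_space std_normal_distribution std_normal_distribution ..
  show ?thesis
    unfolding cscg_def by (rule NN.prob_space_distr[OF measurable_Complex_scaled])
qed

text \<open>The library's \<open>indep_var\<close> requires both random variables to have values in the same type.\<close>

definition indep_pair ::
  "'a measure \<Rightarrow> 'b measure \<Rightarrow> ('a \<Rightarrow> 'b) \<Rightarrow> 'c measure \<Rightarrow> ('a \<Rightarrow> 'c) \<Rightarrow> bool" where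
  "indep_pair M S u T v \<longleftrightarrow>
     u \<in> M \<rightarrow>\<^sub>M S \<and> v \<in> M \<rightarrow>\<^sub>M T \<and>
     prob_space.indep_set M {u -` A \<inter> space M | A. A \<in> sets S} {v -` B \<inter> space M | B. B \<in> sets T}"

definition iid_cscg :: "'a measure \<Rightarrow> 'i set \<Rightarrow> real \<Rightarrow> ('a \<Rightarrow> 'i \<Rightarrow> complex) \<Rightarrow> bool" where
  "iid_cscg M I s u \<longleftrightarrow>
     prob_space.indep_vars M (\<lambda>_. borel) (\<lambda>i \<omega>. u \<omega> i) I \<and>
     (\<forall>i\<in>I. distr M borel (\<lambda>\<omega>. u \<omega> i) = cscg s)"

definition effective_noise ::
  "('p cvec \<Rightarrow> 'p cvec) \<Rightarrow> 'p cvec \<Rightarrow> 'p cvec \<Rightarrow> ('p::finite) cvec" where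
  "effective_noise \<xi> x v = \<xi> (x + v) - x"

definition eta_noisy ::
  "'a measure \<Rightarrow> ('p cvec \<Rightarrow> 'p cvec \<Rightarrow> real) \<Rightarrow> ('p set \<Rightarrow> ('p \<Rightarrow> complex) \<Rightarrow> 'p cvec) \<Rightarrow>
   ('a \<Rightarrow> 'p cvec) \<Rightarrow> ('p set \<Rightarrow> 'a \<Rightarrow> 'p \<Rightarrow> complex) \<Rightarrow> ('p::{finite,linorder}) set \<Rightarrow> real" where
  "eta_noisy M \<eta> g x w \<Omega> =
     prob_space.expectation M (\<lambda>\<omega>. \<eta> (x \<omega>) (g \<Omega> (noisy_samples \<Omega> (x \<omega>) (w \<Omega> \<omega>))))"

end

theory Submission
  imports Defs "HOL-Probability.Hoeffding"
begin

text \<open>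
  The standard Gaussian law on a Euclidean space has a density that depends only on the norm, so it
  is invariant under isometries. The Fourier matrix is unitary, hence the Fourier coefficients of
  the training noise selected by \<open>\<Omega>\<close> have the law of the measurement noise, and
  \<open>(x\<^sub>j, P\<^sub>\<Omega> \<Psi> z\<^sub>j)\<close> has the law of \<open>(x, b)\<close>. By the Lipschitz condition the mean of each
  summand differs from \<open>eta_noisy\<close> by at most \<open>L\<close> times the mean norm of the effective noise. The
  deviation of the average from its mean is controlled by Hoeffding's inequality for each pattern,
  with failure probability \<open>\<delta> / |A|\<close>, and by a union bound over the patterns.
\<close>

subsection \<open>Lebesgue measure and orthogonal transformations\<close>

lemma borel_measurable_orthogonal_transformation:
  fixes f :: "'a::euclidean_space \<Rightarrow> 'a"
  shows "orthogonal_transformation f \<Longrightarrow> f \<in> borel_measurable borel"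
  by (intro borel_measurable_continuous_onI linear_continuous_on)
    (simp add: orthogonal_transformation_linear flip: linear_conv_bounded_linear)

lemma nn_integral_lborel_translation:
  fixes c :: "'a::euclidean_space"
  assumes [measurable]: "h \<in> borel_measurable borel"
  shows "(\<integral>\<^sup>+x. h (c + x) \<partial>lborel) = (\<integral>\<^sup>+x. h x \<partial>lborel)"
proof -
  have "(\<integral>\<^sup>+x. h x \<partial>lborel) = (\<integral>\<^sup>+x. h x \<partial>distr lborel borel ((+) c))"
    by (simp add: lborel_distr_plus)
  also have "\<dots> = (\<integral>\<^sup>+x. h (c + x) \<partial>lborel)"
    by (rule nn_integral_distr) simp_all
  finally show ?thesis ..
qed

text \<open>
  The image measure is translation invariant and agrees with \<open>lborel\<close> on the unit ball. Evaluating
  \<open>\<integral>\<integral> 1\<^sub>A(x) 1\<^sub>B(x - y) dy d\<mu>(x)\<close> in both orders for a ball \<open>B\<close> centred at 0 shows that this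
  determines it.
\<close>

lemma distr_lborel_orthogonal_transformation:
  fixes f :: "'a::euclidean_space \<Rightarrow> 'a"
  assumes f: "orthogonal_transformation f"
  shows "distr lborel borel f = lborel"
proof -
  have lin: "linear f" and bij: "bij f"
    using f by (auto simp: orthogonal_transformation_linear orthogonal_transformation_bij)
  note [measurable] = borel_measurable_orthogonal_transformation[OF f]
  define \<mu> where "\<mu> = distr lborel borel f"
  have sets_mu [measurable_cong]: "sets \<mu> = sets borel" and space_mu: "space \<mu> = UNIV"
    by (simp_all add: \<mu>_def)
  \<comment> \<open>An orthogonal map preserves the norm, so each centred ball is its own preimage.
    The balls of radius \<open>n\<close> then also show that \<open>\<mu>\<close> is sigma-finite,
    as Fubini requires.\<close>
  have ball: "emeasure \<mu> (ball (0::'a) r) = emeasure lborel (ball (0::'a) r)" for r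
  proof -
    have "f -` ball 0 r = ball (0::'a) r"
      using f by (auto simp: orthogonal_transformation_norm)
    then show ?thesis
      by (simp add: \<mu>_def emeasure_distr)
  qed
  interpret mu: sigma_finite_measure \<mu>
  proof
    show "\<exists>A. countable A \<and> A \<subseteq> sets \<mu> \<and> \<Union>A = space \<mu> \<and> (\<forall>a\<in>A. emeasure \<mu> a \<noteq> \<infinity>)"
    proof (intro exI conjI ballI)
      show "\<Union>(range (\<lambda>n::nat. ball (0::'a) n)) = space \<mu>"
        by (auto simp: space_mu reals_Archimedean2)
      show "emeasure \<mu> a \<noteq> \<infinity>" if "a \<in> range (\<lambda>n::nat. ball (0::'a) n)" for a
        using that emeasure_bounded_finite[OF bounded_ball] by (auto simp: ball less_top)
    qed (auto simp: sets_mu)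
  qed
  interpret pair_sigma_finite \<mu> lborel ..
  have trans: "(\<integral>\<^sup>+x. h (x - y) \<partial>\<mu>) = (\<integral>\<^sup>+x. h x \<partial>\<mu>)"
    if [measurable]: "h \<in> borel_measurable borel" for h y
  proof -
    \<comment> \<open>Surjectivity turns a shift by \<open>- y\<close> after \<open>f\<close> into a
      shift by \<open>z\<close> before \<open>f\<close>, where Lebesgue measure absorbs it.\<close>
    obtain z where z: "- y = f z" using bij by (metis bij_pointE)
    have "(\<integral>\<^sup>+x. h (x - y) \<partial>\<mu>) = (\<integral>\<^sup>+x. h (f (z + x)) \<partial>lborel)"
      by (simp add: \<mu>_def nn_integral_distr linear_add[OF lin] flip: z)
    also have "\<dots> = (\<integral>\<^sup>+x. h (f x) \<partial>lborel)"
      by (rule nn_integral_lborel_translation[where h="\<lambda>x. h (f x)"]) simp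
    finally show ?thesis
      by (simp add: \<mu>_def nn_integral_distr)
  qed
  let ?B = "ball (0::'a) 1"
  have B: "emeasure lborel ?B \<noteq> 0" "emeasure lborel ?B \<noteq> \<infinity>"
    using unit_ball_vol_pos[of "DIM('a)"] by (auto simp: emeasure_ball simp del: unit_ball_vol_pos)
  define h :: "'a \<Rightarrow> ennreal" where "h = indicator ?B"
  have [measurable]: "h \<in> borel_measurable borel"
    by (simp add: h_def borel_measurable_indicator)
  have h_lborel: "(\<integral>\<^sup>+x. h x \<partial>lborel) = emeasure lborel ?B"
    and h_mu: "(\<integral>\<^sup>+x. h x \<partial>\<mu>) = emeasure lborel ?B"
    by (simp_all add: h_def sets_mu ball)
  have h_minus: "h (y - x) = h (x - y)" for x y
    by (simp add: h_def indicator_def norm_minus_commute)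
  have "\<mu> = lborel"
  proof (rule measure_eqI)
    fix A assume "A \<in> sets \<mu>"
    then have [measurable]: "A \<in> sets borel" by (simp add: sets_mu)
    have "emeasure \<mu> A * emeasure lborel ?B
        = (\<integral>\<^sup>+x. indicator A x * (\<integral>\<^sup>+y. h y \<partial>lborel) \<partial>\<mu>)"
      by (simp add: nn_integral_multc sets_mu h_lborel)
    \<comment> \<open>The Lebesgue integral of \<open>h\<close> does not change when
      \<open>h\<close> is recentred at \<open>x\<close>. Since the ball is symmetric, the recentred
      integrand may be written \<open>h (x - y)\<close>.\<close>
    also have "\<dots> = (\<integral>\<^sup>+x. indicator A x * (\<integral>\<^sup>+y. h (- x + y) \<partial>lborel) \<partial>\<mu>)"
      by (subst nn_integral_lborel_translation) simp_all
    also have "\<dots> = (\<integral>\<^sup>+x. (\<integral>\<^sup>+y. indicator A x * h (x - y) \<partial>lborel) \<partial>\<mu>)"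
      by (simp add: nn_integral_cmult h_minus)
    also have "\<dots> = (\<integral>\<^sup>+y. (\<integral>\<^sup>+x. indicator A x * h (x - y) \<partial>\<mu>) \<partial>lborel)"
      by (rule Fubini'[symmetric]) measurable
    \<comment> \<open>Invariance of \<open>\<mu>\<close> moves the shift by \<open>y\<close> from
      \<open>h\<close> to the indicator of \<open>A\<close>. After the next exchange of integrals
      the Lebesgue measure of a translate of \<open>A\<close> appears.\<close>
    also have "\<dots> = (\<integral>\<^sup>+y. (\<integral>\<^sup>+x. indicator A (x + y) * h x \<partial>\<mu>) \<partial>lborel)"
      using trans[of "\<lambda>x. indicator A (x + y) * h x" y for y] by simp
    also have "\<dots> = (\<integral>\<^sup>+x. (\<integral>\<^sup>+y. indicator A (x + y) * h x \<partial>lborel) \<partial>\<mu>)"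
      by (rule Fubini') measurable
    also have "\<dots> = (\<integral>\<^sup>+x. emeasure lborel A * h x \<partial>\<mu>)"
      by (simp add: nn_integral_multc nn_integral_lborel_translation[where h="indicator A"])
    also have "\<dots> = emeasure lborel A * emeasure lborel ?B"
      by (simp add: nn_integral_cmult h_mu)
    \<comment> \<open>The volume of the unit ball is neither 0 nor infinite, so it cancels.\<close>
    finally show "emeasure \<mu> A = emeasure lborel A"
      using B by (simp add: ennreal_mult_cancel_left mult.commute[of _ "emeasure lborel ?B"])
  qed (simp add: sets_mu)
  then show ?thesis by (simp add: \<mu>_def)
qed

subsection \<open>The Fourier matrix is unitary\<close>

text \<open>The rank is strictly increasing and stays below \<open>CARD('p)\<close>, so counting
  makes it onto. Sums over the index type become sums over an initial segment of the
  naturals.\<close>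

lemma bij_betw_card_lessThan:
  "bij_betw (\<lambda>i::'p::{finite,linorder}. card {..<i}) UNIV {..<CARD('p)}"
proof -
  have less: "card {..<i} < card {..<k}" if "i < k" for i k :: 'p
    using that by (intro psubset_card_mono) auto
  have inj: "inj (\<lambda>i::'p. card {..<i})"
    by (rule injI) (metis less less_irrefl linorder_neqE)
  have "card {..<i} < CARD('p)" for i :: 'p
    by (intro psubset_card_mono) auto
  then have "range (\<lambda>i::'p. card {..<i}) \<subseteq> {..<CARD('p)}"
    by auto
  then have "range (\<lambda>i::'p. card {..<i}) = {..<CARD('p)}"
    using inj by (intro card_subset_eq) (auto simp: card_image)
  with inj show ?thesis
    by (simp add: bij_betw_def)
qed

text \<open>Each summand is a power of the single number \<open>cis \<theta>\<close>, divided by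
  \<open>CARD('p)\<close>, with the rank of \<open>i\<close> as exponent. The sum is geometric: all
  terms agree when \<open>k = l\<close>, and otherwise the ratio is a root of unity different from
  1, so the sum vanishes.\<close>

lemma fourier_matrix_columns_orthonormal:
  fixes k l :: "'p::{finite,linorder}"
  shows "(\<Sum>i\<in>UNIV. fourier_matrix $ i $ k * cnj (fourier_matrix $ i $ l)) = (if k = l then 1 else 0)"
proof -
  let ?n = "CARD('p)"
  let ?r = "\<lambda>i::'p. card {..<i}"
  define \<theta> where "\<theta> = - 2 * pi * (real (?r k) - real (?r l)) / real ?n"
  have "fourier_matrix $ i $ k * cnj (fourier_matrix $ i $ l) = cis \<theta> ^ ?r i / of_nat ?n" for i
  proof -
    have "complex_of_real (sqrt (real ?n)) * complex_of_real (sqrt (real ?n)) = of_nat ?n"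
      by (simp flip: of_real_mult)
    moreover have "- 2 * pi * real (?r i) * real (?r k) / real ?n
        + - (- 2 * pi * real (?r i) * real (?r l) / real ?n) = real (?r i) * \<theta>"
      unfolding \<theta>_def by (simp add: field_simps)
    ultimately show ?thesis
      by (simp add: fourier_matrix_def cis_cnj cis_mult Complex.DeMoivre)
  qed
  then have "(\<Sum>i\<in>UNIV. fourier_matrix $ i $ k * cnj (fourier_matrix $ i $ l))
      = (\<Sum>i\<in>UNIV. cis \<theta> ^ ?r i) / of_nat ?n"
    by (simp add: sum_divide_distrib)
  also have "(\<Sum>i\<in>UNIV. cis \<theta> ^ ?r i) = (\<Sum>j<?n. cis \<theta> ^ j)"
    by (rule sum.reindex_bij_betw[OF bij_betw_card_lessThan])
  also have "\<dots> / of_nat ?n = (if k = l then 1 else 0)"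
  proof (cases "k = l")
    case True
    then show ?thesis by (simp add: \<theta>_def)
  next
    case False
    have r: "?r k < ?n" "?r l < ?n" "?r k \<noteq> ?r l"
      using bij_betw_card_lessThan[where 'p='p] False by (auto simp: bij_betw_def inj_def)
    have "cis \<theta> ^ ?n = cis (2 * pi * of_int (int (?r l) - int (?r k)))"
    proof -
      have "real ?n * \<theta> = - 2 * pi * (real (?r k) - real (?r l))"
        unfolding \<theta>_def by simp
      also have "\<dots> = 2 * pi * of_int (int (?r l) - int (?r k))"
        by (simp add: algebra_simps)
      finally show ?thesis unfolding Complex.DeMoivre by (rule arg_cong)
    qed
    also have "\<dots> = 1" by (rule cis_multiple_2pi) simp
    finally have one: "cis \<theta> ^ ?n = 1" .
    \<comment> \<open>If \<open>cis \<theta>\<close> were 1, the difference of the two ranks would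
      be a multiple of \<open>CARD('p)\<close>. It is nonzero and smaller than
      \<open>CARD('p)\<close> in absolute value.\<close>
    have "cis \<theta> \<noteq> 1"
    proof
      assume "cis \<theta> = 1"
      then have "cos \<theta> = 1" by (metis cis.sel(1) one_complex.sel(1))
      then obtain j :: int where "\<theta> = of_int j * 2 * pi"
        by (auto simp: cos_one_2pi_int)
      then have "2 * pi * (real (?r l) - real (?r k)) = 2 * pi * (of_int j * real ?n)"
        unfolding \<theta>_def by (simp add: field_simps)
      then have "real_of_int (int (?r l) - int (?r k)) = real_of_int (j * int ?n)"
        by simp
      then have eq: "int (?r l) - int (?r k) = j * int ?n"
        by (simp only: of_int_eq_iff)
      then have "int ?n dvd int (?r l) - int (?r k)" by simp
      then have "int ?n \<le> \<bar>int (?r l) - int (?r k)\<bar>"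
        using r by (intro zdvd_imp_le) (auto simp: dvd_abs_iff)
      then show False using r by linarith
    qed
    then show ?thesis
      using False by (simp add: geometric_sum one)
  qed
  finally show ?thesis .
qed

text \<open>The squared norm expands into a triple sum over a row and two columns. Summing over the
  row first leaves inner products of columns, and orthonormality removes the off-diagonal
  terms.\<close>

lemma norm_fourier_matrix_mult:
  fixes x :: "'p::{finite,linorder} cvec"
  shows "norm (fourier_matrix *v x) = norm x"
proof -
  let ?F = "fourier_matrix :: ('p cvec, 'p) vec"
  have sq: "complex_of_real ((norm y)\<^sup>2) = (\<Sum>i\<in>UNIV. y $ i * cnj (y $ i))" for y :: "'p cvec"
    by (simp add: norm_vec_def L2_set_def sum_nonneg complex_norm_square del: of_real_power)
  have "complex_of_real ((norm (?F *v x))\<^sup>2)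
      = (\<Sum>i\<in>UNIV. \<Sum>k\<in>UNIV. \<Sum>l\<in>UNIV. x $ k * cnj (x $ l) * (?F $ i $ k * cnj (?F $ i $ l)))"
    unfolding sq matrix_vector_mult_def by (simp add: sum_product mult_ac)
  also have "\<dots> = (\<Sum>k\<in>UNIV. \<Sum>i\<in>UNIV. \<Sum>l\<in>UNIV. x $ k * cnj (x $ l) * (?F $ i $ k * cnj (?F $ i $ l)))"
    by (rule sum.swap)
  also have "\<dots> = (\<Sum>k\<in>UNIV. \<Sum>l\<in>UNIV. \<Sum>i\<in>UNIV. x $ k * cnj (x $ l) * (?F $ i $ k * cnj (?F $ i $ l)))"
    by (intro sum.cong refl sum.swap)
  also have "\<dots> = (\<Sum>k\<in>UNIV. \<Sum>l\<in>UNIV. x $ k * cnj (x $ l) * (if k = l then 1 else 0))"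
    by (simp only: sum_distrib_left[symmetric] fourier_matrix_columns_orthonormal)
  also have "\<dots> = complex_of_real ((norm x)\<^sup>2)"
    unfolding sq by (simp add: if_distrib[of "\<lambda>t. _ * t"] cong: if_cong)
  finally have "(norm (?F *v x))\<^sup>2 = (norm x)\<^sup>2"
    by (simp only: of_real_eq_iff)
  then show ?thesis by simp
qed

text \<open>Orthogonality is meant over the reals: \<open>'p cvec\<close> is a real Euclidean space
  of dimension \<open>2 * CARD('p)\<close>, so norm preservation and real linearity suffice.\<close>

lemma orthogonal_transformation_fourier_matrix:
  "orthogonal_transformation ((*v) (fourier_matrix :: ('p::{finite,linorder} cvec, 'p) vec))"
  unfolding orthogonal_transformation
  proof (intro conjI allI linearI)
  show "fourier_matrix *v (r *\<^sub>R x) = r *\<^sub>R (fourier_matrix *v x)" for r and x :: "'p cvec"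
    by (simp add: matrix_vector_mult_def vec_eq_iff scaleR_sum_right)
qed (simp_all add: norm_fourier_matrix_mult matrix_vector_right_distrib)

subsection \<open>Gaussian vectors\<close>

text \<open>The restrictions to the disjoint blocks \<open>{i}\<close> and \<open>{j}\<close> are
  independent, and evaluation at the single index recovers the variables.\<close>

lemma (in prob_space) indep_vars_imp_indep_var:
  assumes "indep_vars M' X I" "i \<in> I" "j \<in> I" "i \<noteq> j"
  shows "indep_var (M' i) (X i) (M' j) (X j)"
proof -
  have "indep_var (PiM {i} M') (\<lambda>\<omega>. restrict (\<lambda>k. X k \<omega>) {i})
      (PiM {j} M') (\<lambda>\<omega>. restrict (\<lambda>k. X k \<omega>) {j})"
    using assms by (intro indep_var_restrict[OF assms(1)]) auto
  then have "indep_var (M' i) ((\<lambda>f. f i) \<circ> (\<lambda>\<omega>. restrict (\<lambda>k. X k \<omega>) {i}))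
      (M' j) ((\<lambda>f. f j) \<circ> (\<lambda>\<omega>. restrict (\<lambda>k. X k \<omega>) {j}))"
    by (rule indep_var_compose) simp_all
  then show ?thesis by (simp add: o_def)
qed

text \<open>The standard Gaussian law. The product over \<open>Basis\<close> makes the coordinates
  independent by construction; rotation invariance appears once the product is rewritten in terms of
  the norm.\<close>

definition gauss_vec :: "'a::euclidean_space measure" where
  "gauss_vec = density lborel (\<lambda>x. \<Prod>b\<in>Basis. ennreal (std_normal_density (x \<bullet> b)))"

lemma sets_gauss_vec [simp, measurable_cong]: "sets gauss_vec = sets borel"
  and space_gauss_vec [simp]: "space gauss_vec = UNIV"
  by (simp_all add: gauss_vec_def)

text \<open>A product measure is determined by its values on boxes. There density and indicator both
  factor over the coordinates, and so does the Lebesgue integral.\<close>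

lemma distr_gauss_vec_PiM:
  "distr gauss_vec (\<Pi>\<^sub>M b\<in>Basis. borel) (\<lambda>x::'a::euclidean_space. \<lambda>b\<in>Basis. x \<bullet> b)
     = (\<Pi>\<^sub>M b\<in>Basis. std_normal_distribution)"
proof -
  interpret N: prob_space std_normal_distribution
    by (rule prob_space_normal_density) simp
  interpret product_sigma_finite "\<lambda>_::'a. std_normal_distribution" ..
  show ?thesis
  proof (rule PiM_eqI)
    show "sets (distr gauss_vec (\<Pi>\<^sub>M b\<in>Basis. borel) (\<lambda>x::'a. \<lambda>b\<in>Basis. x \<bullet> b))
        = sets (\<Pi>\<^sub>M b\<in>Basis. std_normal_distribution)"
      by (simp cong: sets_PiM_cong)
    fix A :: "'a \<Rightarrow> real set" assume A: "\<And>i. i \<in> Basis \<Longrightarrow> A i \<in> sets std_normal_distribution"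
    then have [measurable]: "i \<in> Basis \<Longrightarrow> A i \<in> sets borel" for i by simp
    have "emeasure (distr gauss_vec (\<Pi>\<^sub>M b\<in>Basis. borel) (\<lambda>x::'a. \<lambda>b\<in>Basis. x \<bullet> b)) (Pi\<^sub>E Basis A)
        = emeasure gauss_vec {x. \<forall>b\<in>Basis. x \<bullet> b \<in> A b}"
      by (subst emeasure_distr) (auto simp: PiE_iff intro!: sets_PiM_I_finite arg_cong[where f="emeasure _"])
    also have "\<dots> = (\<integral>\<^sup>+x. (\<Prod>b\<in>Basis. ennreal (std_normal_density (x \<bullet> b)))
        * indicator {x. \<forall>b\<in>Basis. x \<bullet> b \<in> A b} x \<partial>lborel)"
      unfolding gauss_vec_def by (rule emeasure_density) measurable
    also have "\<dots> = (\<integral>\<^sup>+x. (\<Prod>b\<in>Basis. ennreal (std_normal_density (x \<bullet> b)) * indicator (A b) (x \<bullet> b)) \<partial>lborel)"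
    proof (rule nn_integral_cong)
      fix x :: 'a
      have "indicator {x. \<forall>b\<in>Basis. x \<bullet> b \<in> A b} x = (\<Prod>b\<in>Basis. indicator (A b) (x \<bullet> b) :: ennreal)"
        by (auto simp: indicator_def prod_zero_iff)
      then show "(\<Prod>b\<in>Basis. ennreal (std_normal_density (x \<bullet> b))) * indicator {x. \<forall>b\<in>Basis. x \<bullet> b \<in> A b} x
          = (\<Prod>b\<in>Basis. ennreal (std_normal_density (x \<bullet> b)) * indicator (A b) (x \<bullet> b))"
        by (simp add: prod.distrib)
    qed
    also have "\<dots> = (\<Prod>b\<in>Basis. \<integral>\<^sup>+x. ennreal (std_normal_density x) * indicator (A b) x \<partial>lborel)"
      by (rule nn_integral_lborel_prod) simp_all
    also have "\<dots> = (\<Prod>b\<in>Basis. emeasure std_normal_distribution (A b))"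
      by (intro prod.cong refl emeasure_density[symmetric]) simp_all
    finally show "emeasure (distr gauss_vec (\<Pi>\<^sub>M b\<in>Basis. borel) (\<lambda>x::'a. \<lambda>b\<in>Basis. x \<bullet> b)) (Pi\<^sub>E Basis A)
        = (\<Prod>b\<in>Basis. emeasure std_normal_distribution (A b))" .
  qed simp
qed

lemma prob_space_gauss_vec: "prob_space (gauss_vec :: 'a::euclidean_space measure)"
proof
  let ?D = "distr gauss_vec (\<Pi>\<^sub>M b\<in>Basis. borel) (\<lambda>x::'a. \<lambda>b\<in>Basis. x \<bullet> b)"
  interpret D: prob_space ?D
    unfolding distr_gauss_vec_PiM by (intro prob_space_PiM prob_space_normal_density) simp
  have "emeasure (gauss_vec :: 'a measure) UNIV = emeasure ?D (space ?D)"
    by (subst emeasure_distr) (auto simp: space_PiM intro!: arg_cong[where f="emeasure _"])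
  then show "emeasure (gauss_vec :: 'a measure) (space gauss_vec) = 1"
    using D.emeasure_space_1 by simp
qed

lemma distr_gauss_vec_component:
  fixes b :: "'a::euclidean_space"
  assumes b: "b \<in> Basis"
  shows "distr gauss_vec borel (\<lambda>x. x \<bullet> b) = std_normal_distribution"
proof -
  let ?D = "distr gauss_vec (\<Pi>\<^sub>M b\<in>Basis. borel) (\<lambda>x::'a. \<lambda>b\<in>Basis. x \<bullet> b)"
  have "distr ?D borel (\<lambda>f. f b) = distr gauss_vec borel ((\<lambda>f. f b) \<circ> (\<lambda>x::'a. \<lambda>b\<in>Basis. x \<bullet> b))"
    using b by (intro distr_distr) auto
  also have "(\<lambda>f. f b) \<circ> (\<lambda>x::'a. \<lambda>b\<in>Basis. x \<bullet> b) = (\<lambda>x. x \<bullet> b)"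
    using b by auto
  finally have "distr gauss_vec borel (\<lambda>x. x \<bullet> b) = distr ?D borel (\<lambda>f. f b)" ..
  also have "\<dots> = distr (\<Pi>\<^sub>M b\<in>Basis. std_normal_distribution) std_normal_distribution (\<lambda>f. f b)"
    unfolding distr_gauss_vec_PiM by (intro distr_cong) simp_all
  also have "\<dots> = std_normal_distribution"
    by (rule distr_PiM_component) (simp_all add: b prob_space_normal_density)
  finally show ?thesis .
qed

text \<open>Independence is the statement that the joint law of the coordinates is the product of
  their laws; both sides are products of standard normal laws.\<close>

lemma indep_vars_gauss_vec:
  "prob_space.indep_vars gauss_vec (\<lambda>_. borel) (\<lambda>b x. x \<bullet> b) (Basis :: 'a::euclidean_space set)"
proof -
  interpret prob_space "gauss_vec :: 'a measure" by (rule prob_space_gauss_vec)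
  show ?thesis
    by (subst indep_vars_iff_distr_eq_PiM')
      (auto simp: distr_gauss_vec_PiM distr_gauss_vec_component intro!: PiM_cong)
qed

text \<open>The exponents of the one-dimensional densities add up to
  \<open>- (norm x)\<^sup>2 / 2\<close>, so the density is unchanged under \<open>f\<close>, and so
  is Lebesgue measure.\<close>

lemma distr_gauss_vec_orthogonal_transformation:
  fixes f :: "'a::euclidean_space \<Rightarrow> 'a"
  assumes f: "orthogonal_transformation f"
  shows "distr gauss_vec borel f = gauss_vec"
proof -
  note [measurable] = borel_measurable_orthogonal_transformation[OF f]
  let ?h = "\<lambda>x::'a. ennreal ((1 / sqrt (2 * pi)) ^ DIM('a) * exp (- (norm x)\<^sup>2 / 2))"
  have h: "(\<Prod>b\<in>Basis. ennreal (std_normal_density (x \<bullet> b))) = ?h x" for x :: 'a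
  proof -
    have "(norm x)\<^sup>2 = (\<Sum>b\<in>Basis. (x \<bullet> b)\<^sup>2)"
      unfolding power2_norm_eq_inner by (subst euclidean_inner) (simp add: power2_eq_square)
    then have "- (norm x)\<^sup>2 / 2 = (\<Sum>b\<in>Basis. - (x \<bullet> b)\<^sup>2 / 2)"
      by (simp add: sum_negf sum_divide_distrib)
    then have "exp (- (norm x)\<^sup>2 / 2) = (\<Prod>b\<in>Basis. exp (- (x \<bullet> b)\<^sup>2 / 2))"
      by (simp only: exp_sum finite_Basis)
    then show ?thesis
      by (simp add: prod_ennreal std_normal_density_def prod_dividef power_one_over)
  qed
  have G: "gauss_vec = density lborel ?h"
    unfolding gauss_vec_def h ..
  \<comment> \<open>Writing Lebesgue measure as its own image under \<open>f\<close> lets the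
    density be pulled back to \<open>?h (f x)\<close>, which equals \<open>?h x\<close>.\<close>
  have "gauss_vec = density (distr lborel borel f) ?h"
    unfolding G by (simp add: distr_lborel_orthogonal_transformation[OF f])
  also have "\<dots> = distr (density lborel (\<lambda>x. ?h (f x))) borel f"
    by (rule density_distr) simp_all
  also have "\<dots> = distr gauss_vec borel f"
    unfolding G by (simp add: orthogonal_transformation_norm[OF f])
  finally show ?thesis ..
qed

text \<open>This is the reference model for complex Gaussian vectors. The real and imaginary parts
  of the entries are the real coordinates of a standard Gaussian vector, and the factor
  \<open>sqrt (s / 2)\<close> gives each of them variance \<open>s / 2\<close> when \<open>s\<close>
  is nonnegative.\<close>

lemma iid_cscg_gauss_vec:
  fixes s :: real
  defines "\<phi> \<equiv> \<lambda>z :: 'p::finite cvec. sqrt (s / 2) *\<^sub>R z"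
  shows "iid_cscg gauss_vec UNIV s (\<lambda>z i. \<phi> z $ i)"
proof -
  interpret prob_space "gauss_vec :: 'p cvec measure" by (rule prob_space_gauss_vec)
  \<comment> \<open>\<open>K i\<close> holds the two real basis vectors belonging to complex entry
    \<open>i\<close>. These blocks are disjoint, which gives independence across entries; the two
    coordinates inside a block give the real and imaginary part of the entry, rebuilt by
    \<open>\<psi>\<close>.\<close>
  define K where "K = (\<lambda>i::'p. {axis i 1, axis i \<i>} :: 'p cvec set)"
  define \<psi> where "\<psi> = (\<lambda>(i::'p) f. Complex (sqrt (s / 2) * f (axis i 1)) (sqrt (s / 2) * f (axis i \<i>)))"
  have K: "K i \<subseteq> Basis" for i
    by (auto simp: K_def axis_in_Basis_iff Basis_complex_def)
  have ne: "axis i 1 \<noteq> (axis j \<i> :: 'p cvec)" for i j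
    by (auto simp: axis_eq_axis complex_eq_iff)
  have comp: "\<phi> z $ i = \<psi> i (restrict (\<lambda>b. z \<bullet> b) (K i))" for z i
    by (auto simp: \<phi>_def \<psi>_def K_def inner_axis complex_eq_iff inner_complex_def)
  have psi: "\<psi> i \<in> PiM (K i) (\<lambda>_. borel) \<rightarrow>\<^sub>M borel" for i
  proof -
    have "axis i 1 \<in> K i" "axis i \<i> \<in> K i" by (auto simp: K_def)
    then show ?thesis
      unfolding \<psi>_def Complex_eq by measurable
  qed
  have "disjoint_family K"
    by (auto simp: disjoint_family_on_def K_def axis_eq_axis ne ne[symmetric])
  then have "indep_vars (\<lambda>i. PiM (K i) (\<lambda>_. borel)) (\<lambda>i z. restrict (\<lambda>b. z \<bullet> b) (K i)) UNIV"
    using K by (intro indep_vars_restrict[OF indep_vars_gauss_vec]) auto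
  then have "indep_vars (\<lambda>_. borel) (\<lambda>i. \<psi> i \<circ> (\<lambda>z. restrict (\<lambda>b. z \<bullet> b) (K i))) UNIV"
    by (rule indep_vars_compose) (rule psi)
  then have indep: "indep_vars (\<lambda>_. borel) (\<lambda>i z. \<phi> z $ i) UNIV"
    by (simp add: comp o_def)
  have "distr gauss_vec borel (\<lambda>z. \<phi> z $ i) = cscg s" for i
  proof -
    have "indep_vars (\<lambda>_. borel) (\<lambda>b z. z \<bullet> b) (K i)"
      using indep_vars_gauss_vec K by (rule indep_vars_subset)
    then have "indep_var borel (\<lambda>z::'p cvec. z \<bullet> axis i 1) borel (\<lambda>z::'p cvec. z \<bullet> axis i \<i>)"
      by (rule indep_vars_imp_indep_var) (auto simp: K_def ne)
    then have "distr gauss_vec (borel \<Otimes>\<^sub>M borel) (\<lambda>z::'p cvec. (z \<bullet> axis i 1, z \<bullet> axis i \<i>))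
        = distr gauss_vec borel (\<lambda>z::'p cvec. z \<bullet> axis i 1) \<Otimes>\<^sub>M distr gauss_vec borel (\<lambda>z::'p cvec. z \<bullet> axis i \<i>)"
      by (simp add: indep_var_distribution_eq)
    also have "\<dots> = std_normal_distribution \<Otimes>\<^sub>M std_normal_distribution"
      using K[of i] by (simp add: K_def distr_gauss_vec_component)
    finally have "cscg s = distr (distr gauss_vec (borel \<Otimes>\<^sub>M borel) (\<lambda>z::'p cvec. (z \<bullet> axis i 1, z \<bullet> axis i \<i>)))
        borel (\<lambda>(a, b). Complex (sqrt (s / 2) * a) (sqrt (s / 2) * b))"
      unfolding cscg_def by simp
    also have "\<dots> = distr gauss_vec borel ((\<lambda>(a, b). Complex (sqrt (s / 2) * a) (sqrt (s / 2) * b))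
        \<circ> (\<lambda>z::'p cvec. (z \<bullet> axis i 1, z \<bullet> axis i \<i>)))"
      by (rule distr_distr) (simp_all add: Complex_eq)
    also have "(\<lambda>(a, b). Complex (sqrt (s / 2) * a) (sqrt (s / 2) * b))
        \<circ> (\<lambda>z::'p cvec. (z \<bullet> axis i 1, z \<bullet> axis i \<i>)) = (\<lambda>z. \<phi> z $ i)"
      by (auto simp: comp \<psi>_def K_def)
    finally show ?thesis ..
  qed
  with indep show ?thesis
    by (simp add: iid_cscg_def)
qed

section \<open>Random vectors with independent complex Gaussian entries\<close>

lemma distr_iid_cscg:
  assumes "prob_space M" and "finite I" and u: "iid_cscg M I s u"
  shows "distr M (\<Pi>\<^sub>M i\<in>I. borel) (\<lambda>\<omega>. \<lambda>i\<in>I. u \<omega> i) = (\<Pi>\<^sub>M i\<in>I. cscg s)"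
proof -
  interpret prob_space M by fact
  interpret C: prob_space "cscg s" by (rule prob_space_cscg)
  interpret product_sigma_finite "\<lambda>_. cscg s" ..
  have indep: "indep_vars (\<lambda>_. borel) (\<lambda>i \<omega>. u \<omega> i) I"
    and law: "\<And>i. i \<in> I \<Longrightarrow> distr M borel (\<lambda>\<omega>. u \<omega> i) = cscg s"
    using u by (auto simp: iid_cscg_def)
  have meas: "\<And>i. i \<in> I \<Longrightarrow> (\<lambda>\<omega>. u \<omega> i) \<in> borel_measurable M"
    using indep by (simp add: indep_vars_def2)
  have rv: "(\<lambda>\<omega>. \<lambda>i\<in>I. u \<omega> i) \<in> M \<rightarrow>\<^sub>M (\<Pi>\<^sub>M i\<in>I. borel)"
    using meas by (rule measurable_restrict)
  show ?thesis
  \<comment> \<open>The product criterion for independence is applied for nonempty \<open>I\<close>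
    only. The empty index set matters because a sampling pattern may be empty; both measures are
    then the point mass on the only point.\<close>
  proof (cases "I = {}")
    case True
    show ?thesis
    proof (rule PiM_eqI)
      show "sets (distr M (\<Pi>\<^sub>M i\<in>I. borel) (\<lambda>\<omega>. \<lambda>i\<in>I. u \<omega> i)) = sets (\<Pi>\<^sub>M i\<in>I. cscg s)"
        by (simp add: True sets_PiM_empty)
      fix A
      have "(\<lambda>\<omega>. \<lambda>i\<in>I. u \<omega> i) -` Pi\<^sub>E I A \<inter> space M = space M"
        by (auto simp: True)
      then show "emeasure (distr M (\<Pi>\<^sub>M i\<in>I. borel) (\<lambda>\<omega>. \<lambda>i\<in>I. u \<omega> i)) (Pi\<^sub>E I A)
          = (\<Prod>i\<in>I. emeasure (cscg s) (A i))"
        by (subst emeasure_distr[OF rv]) (simp_all add: True sets_PiM_empty emeasure_space_1)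
    qed fact
  next
    case False
    then have "distr M (\<Pi>\<^sub>M i\<in>I. borel) (\<lambda>\<omega>. \<lambda>i\<in>I. u \<omega> i)
        = (\<Pi>\<^sub>M i\<in>I. distr M borel (\<lambda>\<omega>. u \<omega> i))"
      using indep meas by (subst (asm) indep_vars_iff_distr_eq_PiM') auto
    also have "\<dots> = (\<Pi>\<^sub>M i\<in>I. cscg s)"
      by (intro PiM_cong law refl)
    finally show ?thesis .
  qed
qed

lemma borel_measurable_vec_lambda: "vec_lambda \<in> (\<Pi>\<^sub>M i\<in>UNIV. borel) \<rightarrow>\<^sub>M (borel :: ('a::euclidean_space ^ 'n) measure)"
  by (subst borel_measurable_euclidean_space) (auto simp: Basis_vec_def inner_axis)

lemma borel_measurable_vec_nth [measurable]: "(\<lambda>x :: 'a::euclidean_space ^ 'n. x $ i) \<in> borel_measurable borel"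
  by (intro borel_measurable_continuous_onI linear_continuous_on bounded_linear_vec_nth)

lemma borel_measurable_iid_cscg:
  assumes "prob_space M" and "iid_cscg M UNIV s (\<lambda>\<omega> i. V \<omega> $ i)"
  shows "V \<in> borel_measurable M"
proof -
  interpret prob_space M by fact
  have "(\<lambda>\<omega>. \<lambda>i\<in>UNIV. V \<omega> $ i) \<in> M \<rightarrow>\<^sub>M (\<Pi>\<^sub>M i\<in>UNIV. borel)"
    using assms(2) by (auto simp: iid_cscg_def indep_vars_def2 intro!: measurable_restrict)
  from measurable_compose[OF this borel_measurable_vec_lambda] show ?thesis
    by (simp add: restrict_UNIV vec_lambda_eta)
qed

lemma distr_vec_iid_cscg:
  fixes V :: "'a \<Rightarrow> 'p::finite cvec"
  assumes M: "prob_space M" and V: "iid_cscg M UNIV s (\<lambda>\<omega> i. V \<omega> $ i)"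
  shows "distr M borel V = distr gauss_vec borel (\<lambda>z. sqrt (s / 2) *\<^sub>R z)"
proof -
  \<comment> \<open>The probability space is left arbitrary so that the claim applies both to
    \<open>M\<close> and to the reference model on \<open>gauss_vec\<close>: the product law of the
    entries determines the law of the vector.\<close>
  have *: "distr N borel W = distr (\<Pi>\<^sub>M i\<in>UNIV. cscg s) borel vec_lambda"
    if N: "prob_space N" and W: "iid_cscg N UNIV s (\<lambda>\<omega> i. W \<omega> $ i)"
    for N :: "'b measure" and W :: "'b \<Rightarrow> 'p cvec"
  proof -
    have [measurable]: "W \<in> borel_measurable N"
      using that by (rule borel_measurable_iid_cscg)
    have "distr (distr N (\<Pi>\<^sub>M i\<in>UNIV. borel) (\<lambda>\<omega>. \<lambda>i\<in>UNIV. W \<omega> $ i)) borel vec_lambda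
        = distr N borel (vec_lambda \<circ> (\<lambda>\<omega>. \<lambda>i\<in>UNIV. W \<omega> $ i))"
      by (intro distr_distr borel_measurable_vec_lambda) measurable
    also have "\<dots> = distr N borel W"
      by (simp add: o_def restrict_UNIV vec_lambda_eta)
    finally show ?thesis
      using distr_iid_cscg[OF N _ W] by simp
  qed
  show ?thesis
    unfolding *[OF M V] by (rule *[OF prob_space_gauss_vec iid_cscg_gauss_vec, symmetric])
qed

text \<open>\<open>V\<close> has the law of a scaled standard Gaussian vector. Being linear,
  \<open>f\<close> commutes with the scaling, so the invariance of \<open>gauss_vec\<close> carries
  over.\<close>

lemma distr_orthogonal_transformation_iid_cscg:
  fixes V :: "'a \<Rightarrow> 'p::finite cvec"
  assumes M: "prob_space M" and V: "iid_cscg M UNIV s (\<lambda>\<omega> i. V \<omega> $ i)"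
    and f: "orthogonal_transformation f"
  shows "distr M borel (\<lambda>\<omega>. f (V \<omega>)) = distr M borel V"
proof -
  note [measurable] = borel_measurable_orthogonal_transformation[OF f] borel_measurable_iid_cscg[OF M V]
  let ?\<phi> = "\<lambda>z::'p cvec. sqrt (s / 2) *\<^sub>R z"
  have "distr M borel (\<lambda>\<omega>. f (V \<omega>)) = distr (distr M borel V) borel f"
    by (simp add: distr_distr o_def)
  also have "\<dots> = distr gauss_vec borel (\<lambda>z. ?\<phi> (f z))"
    unfolding distr_vec_iid_cscg[OF M V]
    by (simp add: distr_distr o_def orthogonal_transformation_scaleR[OF f])
  also have "\<dots> = distr (distr gauss_vec borel f) borel ?\<phi>"
    by (simp add: distr_distr o_def)
  also have "\<dots> = distr M borel V"
    unfolding distr_gauss_vec_orthogonal_transformation[OF f] distr_vec_iid_cscg[OF M V] ..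
  finally show ?thesis .
qed

lemma measurable_subsample: "subsample \<Omega> \<in> borel \<rightarrow>\<^sub>M (\<Pi>\<^sub>M i\<in>\<Omega>. borel)"
  unfolding subsample_def by measurable

text \<open>The Fourier transform of \<open>V\<close> has the law of \<open>V\<close>, so selecting
  the coordinates in \<open>\<Omega>\<close> yields a subfamily of independent entries with the
  original law.\<close>

lemma distr_subsample_fourier_iid_cscg:
  fixes V :: "'a \<Rightarrow> 'p::{finite,linorder} cvec"
  assumes M: "prob_space M" and V: "iid_cscg M UNIV s (\<lambda>\<omega> i. V \<omega> $ i)"
  shows "distr M (\<Pi>\<^sub>M i\<in>\<Omega>. borel) (\<lambda>\<omega>. subsample \<Omega> (fourier_matrix *v V \<omega>)) = (\<Pi>\<^sub>M i\<in>\<Omega>. cscg s)"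
proof -
  interpret prob_space M by fact
  note [measurable] = measurable_subsample borel_measurable_iid_cscg[OF M V]
    borel_measurable_orthogonal_transformation[OF orthogonal_transformation_fourier_matrix]
  have "distr M (\<Pi>\<^sub>M i\<in>\<Omega>. borel) (\<lambda>\<omega>. subsample \<Omega> (fourier_matrix *v V \<omega>))
      = distr (distr M borel (\<lambda>\<omega>. fourier_matrix *v V \<omega>)) (\<Pi>\<^sub>M i\<in>\<Omega>. borel) (subsample \<Omega>)"
    by (simp add: distr_distr o_def)
  also have "\<dots> = distr (distr M borel V) (\<Pi>\<^sub>M i\<in>\<Omega>. borel) (subsample \<Omega>)"
    by (simp add: distr_orthogonal_transformation_iid_cscg[OF M V]
        orthogonal_transformation_fourier_matrix)
  also have "\<dots> = distr M (\<Pi>\<^sub>M i\<in>\<Omega>. borel) (\<lambda>\<omega>. \<lambda>i\<in>\<Omega>. V \<omega> $ i)"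
    by (simp add: distr_distr o_def subsample_def)
  also have "\<dots> = (\<Pi>\<^sub>M i\<in>\<Omega>. cscg s)"
    using V by (intro distr_iid_cscg[OF M]) (auto simp: iid_cscg_def intro: indep_vars_subset)
  finally show ?thesis .
qed

text \<open>The norm is at most the sum of the absolute real coordinates, each with a finite first
  moment. Finiteness here makes the effective noise integrable, so that its mean norm is a genuine
  expectation and not the default value 0 of a divergent integral.\<close>

lemma nn_integral_norm_iid_cscg_finite:
  fixes V :: "'a \<Rightarrow> 'p::finite cvec"
  assumes M: "prob_space M" and V: "iid_cscg M UNIV s (\<lambda>\<omega> i. V \<omega> $ i)"
  shows "(\<integral>\<^sup>+\<omega>. ennreal (norm (V \<omega>)) \<partial>M) < \<infinity>"
proof -
  note [measurable] = borel_measurable_iid_cscg[OF M V]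
  have comp: "(\<integral>\<^sup>+z. ennreal \<bar>z \<bullet> b\<bar> \<partial>gauss_vec) < \<infinity>" if b: "b \<in> Basis" for b :: "'p cvec"
  proof -
    have "integrable lborel (\<lambda>x. std_normal_density x * \<bar>x\<bar>)"
      using integrable_std_normal_moment_abs[of 1] by simp
    then have "integrable std_normal_distribution abs"
      by (subst integrable_density) simp_all
    then have "(\<integral>\<^sup>+x. ennreal \<bar>x\<bar> \<partial>distr gauss_vec borel (\<lambda>z. z \<bullet> b)) < \<infinity>"
      by (simp add: distr_gauss_vec_component[OF b] integrable_iff_bounded)
    then show ?thesis
      by (simp add: nn_integral_distr)
  qed
  have "(\<integral>\<^sup>+\<omega>. ennreal (norm (V \<omega>)) \<partial>M) = (\<integral>\<^sup>+z. ennreal (norm z) \<partial>distr M borel V)"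
    by (simp add: nn_integral_distr)
  also have "\<dots> = (\<integral>\<^sup>+z. ennreal \<bar>sqrt (s / 2)\<bar> * ennreal (norm (z :: 'p cvec)) \<partial>gauss_vec)"
    unfolding distr_vec_iid_cscg[OF M V] by (simp add: nn_integral_distr ennreal_mult)
  also have "\<dots> \<le> (\<integral>\<^sup>+z. ennreal \<bar>sqrt (s / 2)\<bar> * (\<Sum>b\<in>Basis. ennreal \<bar>(z :: 'p cvec) \<bullet> b\<bar>) \<partial>gauss_vec)"
    by (intro nn_integral_mono mult_left_mono) (simp_all add: norm_le_l1 sum_ennreal ennreal_leI)
  also have "\<dots> = ennreal \<bar>sqrt (s / 2)\<bar> * (\<Sum>b\<in>Basis. \<integral>\<^sup>+z. ennreal \<bar>(z :: 'p cvec) \<bullet> b\<bar> \<partial>gauss_vec)"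
    by (simp add: nn_integral_cmult nn_integral_sum del: sum_ennreal)
  also have "\<dots> < \<infinity>"
    using comp by (simp add: ennreal_mult_less_top)
  finally show ?thesis .
qed

text \<open>Two measures that agree on rectangles agree on the product space, and on rectangles the
  claim is independence of the two preimages.\<close>

lemma distr_indep_pair:
  assumes "prob_space M" and uv: "indep_pair M S u T v"
  shows "distr M (S \<Otimes>\<^sub>M T) (\<lambda>\<omega>. (u \<omega>, v \<omega>)) = distr M S u \<Otimes>\<^sub>M distr M T v"
proof (rule pair_measure_eqI[symmetric])
  interpret prob_space M by fact
  have [measurable]: "u \<in> M \<rightarrow>\<^sub>M S" "v \<in> M \<rightarrow>\<^sub>M T"
    and indep: "indep_set {u -` A \<inter> space M | A. A \<in> sets S} {v -` B \<inter> space M | B. B \<in> sets T}"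
    using uv by (auto simp: indep_pair_def)
  interpret u: prob_space "distr M S u" by (rule prob_space_distr) simp
  interpret v: prob_space "distr M T v" by (rule prob_space_distr) simp
  show "sigma_finite_measure (distr M S u)" "sigma_finite_measure (distr M T v)" ..
  show "sets (distr M S u \<Otimes>\<^sub>M distr M T v) = sets (distr M (S \<Otimes>\<^sub>M T) (\<lambda>\<omega>. (u \<omega>, v \<omega>)))"
    by (simp cong: sets_pair_measure_cong)
  fix A B assume "A \<in> sets (distr M S u)" "B \<in> sets (distr M T v)"
  then have [measurable]: "A \<in> sets S" "B \<in> sets T" by simp_all
  have "(\<lambda>\<omega>. (u \<omega>, v \<omega>)) -` (A \<times> B) \<inter> space M = (u -` A \<inter> space M) \<inter> (v -` B \<inter> space M)"
    by auto
  moreover have "prob ((u -` A \<inter> space M) \<inter> (v -` B \<inter> space M))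
      = prob (u -` A \<inter> space M) * prob (v -` B \<inter> space M)"
    by (rule indep_setD[OF indep]) auto
  ultimately show "emeasure (distr M S u) A * emeasure (distr M T v) B
      = emeasure (distr M (S \<Otimes>\<^sub>M T) (\<lambda>\<omega>. (u \<omega>, v \<omega>))) (A \<times> B)"
    by (simp add: emeasure_distr emeasure_eq_measure ennreal_mult)
qed

subsection \<open>Uniform deviation and bias\<close>

text \<open>The two-sided Hoeffding bound is applied to each member of \<open>A\<close>, and the
  failure probabilities are added. Independence is required only over \<open>I\<close>; the families
  for different members of \<open>A\<close> may depend on each other.\<close>

lemma (in prob_space) Hoeffding_ineq_uniform:
  fixes Y :: "'b \<Rightarrow> 'c \<Rightarrow> 'a \<Rightarrow> real"
  assumes A: "finite A" and I: "finite I" "I \<noteq> {}"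
    and indep: "\<And>a. a \<in> A \<Longrightarrow> indep_vars (\<lambda>_. borel) (Y a) I"
    and range: "\<And>a i \<omega>. a \<in> A \<Longrightarrow> i \<in> I \<Longrightarrow> Y a i \<omega> \<in> {0..1}"
    and \<delta>: "0 < \<delta>" "\<delta> < 1"
  defines "n \<equiv> real (card I)"
  shows "1 - \<delta> \<le> \<P>(\<omega> in M. \<forall>a\<in>A.
      \<bar>(\<Sum>i\<in>I. Y a i \<omega>) / n - (\<Sum>i\<in>I. expectation (Y a i)) / n\<bar>
        \<le> sqrt (1 / (2 * n) * ln (2 * real (card A) / \<delta>)))"
\<comment> \<open>With no member in \<open>A\<close> the event is the whole space, whatever the
  value of the logarithm at 0.\<close>
proof (cases "A = {}")
  case True
  then show ?thesis using \<delta> by (simp add: prob_space)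
next
  case False
  have n: "n > 0" using I by (simp add: n_def card_gt_0_iff)
  have cA: "real (card A) \<ge> 1" using A False by (simp add: Suc_le_eq card_gt_0_iff)
  define t where "t = sqrt (1 / (2 * n) * ln (2 * real (card A) / \<delta>))"
  \<comment> \<open>The argument of the logarithm is at least 1, so \<open>t\<close> is the square
    root of a nonnegative number and \<open>t\<^sup>2\<close> has the intended value.\<close>
  have ln: "ln (2 * real (card A) / \<delta>) \<ge> 0"
    using \<delta> cA by (intro ln_ge_zero) (simp add: field_simps)
  have t0: "t \<ge> 0" and t2: "t\<^sup>2 = 1 / (2 * n) * ln (2 * real (card A) / \<delta>)"
    using ln n by (simp_all add: t_def)
  have [measurable]: "Y a i \<in> borel_measurable M" if "a \<in> A" "i \<in> I" for a i
    using indep[OF that(1)] that(2) by (simp add: indep_vars_def2)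
  define bad where "bad a = {\<omega>\<in>space M. \<bar>(\<Sum>i\<in>I. Y a i \<omega>) - (\<Sum>i\<in>I. expectation (Y a i))\<bar> \<ge> n * t}" for a
  have bad_meas: "bad a \<in> events" if [simp]: "a \<in> A" for a
    unfolding bad_def by measurable
  have bad_prob: "prob (bad a) \<le> \<delta> / real (card A)" if a: "a \<in> A" for a
  proof -
    interpret H: Hoeffding_ineq M I "Y a" "\<lambda>_. 0" "\<lambda>_. 1" "\<Sum>i\<in>I. expectation (Y a i)"
      by unfold_locales (use I indep[OF a] range[OF a] in auto)
    have "prob (bad a) \<le> 2 * exp (- 2 * (n * t)\<^sup>2 / (\<Sum>i\<in>I. (1 - 0)\<^sup>2))"
      unfolding bad_def using n t0 I by (intro H.Hoeffding_ineq_abs_ge) (simp_all add: card_gt_0_iff)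
    \<comment> \<open>All ranges have width 1, so the denominator is \<open>n\<close> and the
      exponent is \<open>- 2 * n * t\<^sup>2\<close>. The choice of \<open>t\<close> makes it the
      negated logarithm, so each pattern fails with probability at most
      \<open>\<delta> / real (card A)\<close>.\<close>
    also have "- 2 * (n * t)\<^sup>2 / (\<Sum>i\<in>I. (1 - 0)\<^sup>2) = - ln (2 * real (card A) / \<delta>)"
      using n by (simp add: power_mult_distrib t2 flip: n_def) (simp add: power2_eq_square)
    also have "2 * exp (- ln (2 * real (card A) / \<delta>)) = \<delta> / real (card A)"
      using \<delta> cA by (simp add: exp_minus field_simps)
    finally show ?thesis .
  qed
  have "prob (\<Union>a\<in>A. bad a) \<le> (\<Sum>a\<in>A. prob (bad a))"
    using A bad_meas by (intro finite_measure_subadditive_finite) auto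
  also have "\<dots> \<le> (\<Sum>a\<in>A. \<delta> / real (card A))"
    by (intro sum_mono bad_prob)
  also have "\<dots> = \<delta>" using cA by simp
  finally have "1 - \<delta> \<le> prob (space M - (\<Union>a\<in>A. bad a))"
    using A bad_meas by (subst prob_compl) (auto intro: sets.finite_UN)
  also have "\<dots> \<le> \<P>(\<omega> in M. \<forall>a\<in>A.
      \<bar>(\<Sum>i\<in>I. Y a i \<omega>) / n - (\<Sum>i\<in>I. expectation (Y a i)) / n\<bar> \<le> t)"
  proof (rule finite_measure_mono)
    show "space M - (\<Union>a\<in>A. bad a) \<subseteq> {\<omega>\<in>space M. \<forall>a\<in>A.
      \<bar>(\<Sum>i\<in>I. Y a i \<omega>) / n - (\<Sum>i\<in>I. expectation (Y a i)) / n\<bar> \<le> t}"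
    proof safe
      fix \<omega> a assume \<omega>: "\<omega> \<in> space M" "\<omega> \<notin> (\<Union>a\<in>A. bad a)" and a: "a \<in> A"
      then have "\<bar>(\<Sum>i\<in>I. Y a i \<omega>) - (\<Sum>i\<in>I. expectation (Y a i))\<bar> / n \<le> t"
        using n by (auto simp: bad_def field_simps not_le)
      then show "\<bar>(\<Sum>i\<in>I. Y a i \<omega>) / n - (\<Sum>i\<in>I. expectation (Y a i)) / n\<bar> \<le> t"
        using n by (simp flip: diff_divide_distrib)
    qed
    show "{\<omega>\<in>space M. \<forall>a\<in>A.
      \<bar>(\<Sum>i\<in>I. Y a i \<omega>) / n - (\<Sum>i\<in>I. expectation (Y a i)) / n\<bar> \<le> t} \<in> events"
      using A by measurable
  qed
  finally show ?thesis unfolding t_def .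
qed

section \<open>The law of the training samples and the bias caused by denoising\<close>

lemma noisy_samples_add:
  fixes x v :: "'p::{finite,linorder} cvec"
  shows "subsample \<Omega> (fourier_matrix *v (x + v))
    = noisy_samples \<Omega> x (subsample \<Omega> (fourier_matrix *v v))"
  by (auto simp: subsample_def noisy_samples_def matrix_vector_right_distrib fun_eq_iff)

lemma measurable_noisy_samples:
  "(\<lambda>(x, w). noisy_samples \<Omega> x w) \<in> borel \<Otimes>\<^sub>M (\<Pi>\<^sub>M i\<in>\<Omega>. borel) \<rightarrow>\<^sub>M (\<Pi>\<^sub>M i\<in>\<Omega>. borel)"
proof -
  note [measurable] =
    borel_measurable_orthogonal_transformation[OF orthogonal_transformation_fourier_matrix]
  show ?thesis
    unfolding noisy_samples_def case_prod_beta
  proof (intro measurable_restrict borel_measurable_add)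
    fix i assume i: "i \<in> \<Omega>"
    then show "(\<lambda>z. subsample \<Omega> (fourier_matrix *v fst z) i)
        \<in> borel_measurable (borel \<Otimes>\<^sub>M (\<Pi>\<^sub>M i\<in>\<Omega>. borel))"
      unfolding subsample_def by simp
    show "(\<lambda>z. snd z i) \<in> borel_measurable (borel \<Otimes>\<^sub>M (\<Pi>\<^sub>M i\<in>\<Omega>. borel))"
      by (rule measurable_compose[OF measurable_snd measurable_component_singleton[OF i]])
  qed
qed

text \<open>Both pairs have independent components, so each joint law is a product, and the factors
  agree: the signals by assumption, the noises because the Fourier coefficients of \<open>V\<close>
  in \<open>\<Omega>\<close> are again independent complex Gaussians of the same variance.\<close>

lemma distr_signal_samples_eq:
  fixes x X V :: "'a \<Rightarrow> 'p::{finite,linorder} cvec"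
  assumes M: "prob_space M"
    and xw: "indep_pair M borel x (\<Pi>\<^sub>M i\<in>\<Omega>. borel) w"
    and w: "iid_cscg M \<Omega> s w"
    and XV: "prob_space.indep_var M borel X borel V"
    and X: "distr M borel X = distr M borel x"
    and V: "iid_cscg M UNIV s (\<lambda>\<omega> i. V \<omega> $ i)"
  shows "distr M (borel \<Otimes>\<^sub>M (\<Pi>\<^sub>M i\<in>\<Omega>. borel)) (\<lambda>\<omega>. (X \<omega>, subsample \<Omega> (fourier_matrix *v V \<omega>)))
    = distr M (borel \<Otimes>\<^sub>M (\<Pi>\<^sub>M i\<in>\<Omega>. borel)) (\<lambda>\<omega>. (x \<omega>, w \<omega>))"
proof -
  interpret prob_space M by fact
  let ?S = "(\<Pi>\<^sub>M i\<in>\<Omega>. borel) :: ('p \<Rightarrow> complex) measure"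
  let ?f = "\<lambda>v. subsample \<Omega> (fourier_matrix *v v)"
  note [measurable] = measurable_subsample
    borel_measurable_orthogonal_transformation[OF orthogonal_transformation_fourier_matrix]
  have [measurable]: "X \<in> borel_measurable M" "V \<in> borel_measurable M" "w \<in> M \<rightarrow>\<^sub>M ?S"
    using XV xw by (auto simp: indep_var_distribution_eq indep_pair_def)
  \<comment> \<open>Values of \<open>w\<close> lie in the product space and are therefore
    \<open>undefined\<close> outside \<open>\<Omega>\<close>, so restricting to
    \<open>\<Omega>\<close> changes nothing and the product law applies to \<open>w\<close>
    itself.\<close>
  have "(\<lambda>\<omega>. \<lambda>i\<in>\<Omega>. w \<omega> i) \<omega> = w \<omega>" if "\<omega> \<in> space M" for \<omega>
    using measurable_space[OF \<open>w \<in> M \<rightarrow>\<^sub>M ?S\<close> that] by (auto simp: space_PiM PiE_def extensional_restrict)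
  then have "distr M ?S w = distr M ?S (\<lambda>\<omega>. \<lambda>i\<in>\<Omega>. w \<omega> i)"
    by (intro distr_cong) auto
  then have law: "distr M ?S w = distr M ?S (\<lambda>\<omega>. ?f (V \<omega>))"
    by (simp add: distr_iid_cscg[OF M _ w] distr_subsample_fourier_iid_cscg[OF M V])
  interpret D: prob_space "distr M ?S (\<lambda>\<omega>. ?f (V \<omega>))"
    by (rule prob_space_distr) measurable
  have fV: "distr (distr M borel V) ?S ?f = distr M ?S (\<lambda>\<omega>. ?f (V \<omega>))"
    by (simp add: distr_distr o_def)
  \<comment> \<open>Independence of \<open>X\<close> and \<open>V\<close> passes to \<open>X\<close>
    and \<open>?f\<close> applied to \<open>V\<close>: the product law is pushed forward in its
    second component.\<close>
  have "distr M (borel \<Otimes>\<^sub>M ?S) (\<lambda>\<omega>. (X \<omega>, ?f (V \<omega>)))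
      = distr (distr M (borel \<Otimes>\<^sub>M borel) (\<lambda>\<omega>. (X \<omega>, V \<omega>))) (borel \<Otimes>\<^sub>M ?S) (\<lambda>(a, b). (a, ?f b))"
    by (subst distr_distr) (auto simp: o_def)
  also have "\<dots> = distr (distr M borel X \<Otimes>\<^sub>M distr M borel V) (borel \<Otimes>\<^sub>M ?S) (\<lambda>(a, b). (a, ?f b))"
    using XV by (simp add: indep_var_distribution_eq)
  also have "\<dots> = distr (distr M borel X) borel (\<lambda>a. a) \<Otimes>\<^sub>M distr (distr M borel V) ?S ?f"
    by (rule pair_measure_distr[symmetric]) (auto simp: fV D.sigma_finite_measure_axioms)
  also have "\<dots> = distr M borel x \<Otimes>\<^sub>M distr M ?S w"
    by (simp add: fV law X[symmetric] distr_distr o_def)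
  also have "\<dots> = distr M (borel \<Otimes>\<^sub>M ?S) (\<lambda>\<omega>. (x \<omega>, w \<omega>))"
    by (rule distr_indep_pair[OF M xw, symmetric])
  finally show ?thesis .
qed

text \<open>The intermediate quantity compares the clean signal \<open>X\<close> with the estimate
  from noisy samples. Its mean is exactly \<open>eta_noisy\<close> by equality of laws. Replacing
  \<open>X\<close> by the denoised signal alters only the first argument of \<open>\<eta>\<close>,
  at a pointwise cost of \<open>L\<close> times the norm of the effective noise.\<close>

lemma expectation_denoised_error:
  fixes x X V :: "'a \<Rightarrow> 'p::{finite,linorder} cvec" and w :: "'p set \<Rightarrow> 'a \<Rightarrow> 'p \<Rightarrow> complex"
  assumes M: "prob_space M"
    and g: "g \<Omega> \<in> (\<Pi>\<^sub>M i\<in>\<Omega>. borel) \<rightarrow>\<^sub>M borel"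
    and \<eta>: "(\<lambda>(y, y'). \<eta> y y') \<in> borel_measurable (borel \<Otimes>\<^sub>M borel)"
    and \<xi>: "\<xi> \<in> borel_measurable borel"
    and xw: "indep_pair M borel x (\<Pi>\<^sub>M i\<in>\<Omega>. borel) (w \<Omega>)"
    and w: "iid_cscg M \<Omega> s (w \<Omega>)"
    and XV: "prob_space.indep_var M borel X borel V"
    and X: "distr M borel X = distr M borel x"
    and V: "iid_cscg M UNIV s (\<lambda>\<omega> i. V \<omega> $ i)"
    and noise: "(\<integral>\<^sup>+\<omega>. ennreal (norm (effective_noise \<xi> (X \<omega>) (V \<omega>))) \<partial>M)
        \<le> (\<integral>\<^sup>+\<omega>. ennreal (norm (V \<omega>)) \<partial>M)"
    and range: "\<And>y y'. 0 \<le> \<eta> y y' \<and> \<eta> y y' \<le> 1"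
    and lipschitz: "\<And>y y' z. \<bar>\<eta> y z - \<eta> y' z\<bar> \<le> L * norm (y - y')"
  shows "\<bar>prob_space.expectation M (\<lambda>\<omega>. \<eta> (X \<omega> + effective_noise \<xi> (X \<omega>) (V \<omega>))
          (g \<Omega> (subsample \<Omega> (fourier_matrix *v (X \<omega> + V \<omega>))))) - eta_noisy M \<eta> g x w \<Omega>\<bar>
      \<le> L * prob_space.expectation M (\<lambda>\<omega>. norm (effective_noise \<xi> (X \<omega>) (V \<omega>)))"
proof -
  interpret prob_space M by fact
  let ?S = "(\<Pi>\<^sub>M i\<in>\<Omega>. borel) :: ('p \<Rightarrow> complex) measure"
  let ?f = "\<lambda>v. subsample \<Omega> (fourier_matrix *v v)"
  let ?e = "\<lambda>\<omega>. effective_noise \<xi> (X \<omega>) (V \<omega>)"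
  let ?h = "\<lambda>\<omega>. g \<Omega> (?f (X \<omega> + V \<omega>))"
  note [measurable] = measurable_subsample g \<xi> measurable_noisy_samples[of \<Omega>]
    borel_measurable_orthogonal_transformation[OF orthogonal_transformation_fourier_matrix]
  have [measurable]: "X \<in> borel_measurable M" "V \<in> borel_measurable M"
      "x \<in> borel_measurable M" "w \<Omega> \<in> M \<rightarrow>\<^sub>M ?S"
    using XV xw by (auto simp: indep_var_distribution_eq indep_pair_def)
  have eta_meas [measurable]: "(\<lambda>\<omega>. \<eta> (a \<omega>) (b \<omega>)) \<in> borel_measurable N"
    if "a \<in> borel_measurable N" "b \<in> borel_measurable N" for a b and N :: "'c measure"
    using measurable_compose[OF measurable_Pair[OF that] \<eta>] by simp
  have e_meas [measurable]: "?e \<in> borel_measurable M"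
    unfolding effective_noise_def by measurable
  \<comment> \<open>The effective noise is integrable because its mean norm is bounded by that of
    the Gaussian noise, which is finite.\<close>
  have e_int: "integrable M ?e"
    using noise nn_integral_norm_iid_cscg_finite[OF M V]
    by (simp add: integrable_iff_bounded)
  have int: "integrable M (\<lambda>\<omega>. \<eta> (a \<omega>) (b \<omega>))"
    if [measurable]: "a \<in> borel_measurable M" "b \<in> borel_measurable M" for a b
    by (rule integrable_const_bound[of _ 1]) (use range in auto)
  have [measurable]: "(\<lambda>(a, b). \<eta> a (g \<Omega> (noisy_samples \<Omega> a b))) \<in> borel_measurable (borel \<Otimes>\<^sub>M ?S)"
    using measurable_compose[OF measurable_noisy_samples[of \<Omega>] g]
    by (auto simp: case_prod_beta intro!: measurable_compose[OF measurable_Pair[OF measurable_fst] \<eta>])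
  \<comment> \<open>By linearity of the Fourier transform the samples of \<open>X + V\<close> are
    those of \<open>X\<close> perturbed by the coefficients of \<open>V\<close>, so the integrand is
    a function of the pair whose law is known.\<close>
  have "expectation (\<lambda>\<omega>. \<eta> (X \<omega>) (?h \<omega>))
      = (\<integral>z. (\<lambda>(a, b). \<eta> a (g \<Omega> (noisy_samples \<Omega> a b))) z
          \<partial>distr M (borel \<Otimes>\<^sub>M ?S) (\<lambda>\<omega>. (X \<omega>, ?f (V \<omega>))))"
    by (subst integral_distr) (simp_all add: noisy_samples_add)
  also have "\<dots> = eta_noisy M \<eta> g x w \<Omega>"
    unfolding distr_signal_samples_eq[OF M xw w XV X V] eta_noisy_def
    by (subst integral_distr) simp_all
  finally have "\<bar>expectation (\<lambda>\<omega>. \<eta> (X \<omega> + ?e \<omega>) (?h \<omega>)) - eta_noisy M \<eta> g x w \<Omega>\<bar>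
      = \<bar>expectation (\<lambda>\<omega>. \<eta> (X \<omega> + ?e \<omega>) (?h \<omega>) - \<eta> (X \<omega>) (?h \<omega>))\<bar>"
    by (simp add: int)
  also have "\<dots> \<le> expectation (\<lambda>\<omega>. \<bar>\<eta> (X \<omega> + ?e \<omega>) (?h \<omega>) - \<eta> (X \<omega>) (?h \<omega>)\<bar>)"
    by (rule integral_abs_bound)
  also have "\<dots> \<le> expectation (\<lambda>\<omega>. L * norm (?e \<omega>))"
  proof (rule integral_mono)
    show "\<bar>\<eta> (X \<omega> + ?e \<omega>) (?h \<omega>) - \<eta> (X \<omega>) (?h \<omega>)\<bar> \<le> L * norm (?e \<omega>)" for \<omega>
      using lipschitz[of "X \<omega> + ?e \<omega>" "?h \<omega>" "X \<omega>"] by simp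
    show "integrable M (\<lambda>\<omega>. \<bar>\<eta> (X \<omega> + ?e \<omega>) (?h \<omega>) - \<eta> (X \<omega>) (?h \<omega>)\<bar>)"
      by (intro integrable_abs Bochner_Integration.integrable_diff int) measurable
  qed (simp add: e_int)
  finally show ?thesis by simp
qed

text \<open>The summand at \<open>i\<close> reads only the block \<open>{Inl i, Inr i}\<close> of
  the joint family, and these blocks are disjoint.\<close>

lemma (in prob_space) indep_vars_case_sum:
  assumes indep: "indep_vars (\<lambda>_. N) (case_sum X V) (I <+> I)"
    and h: "(\<lambda>(a, b). h a b) \<in> N \<Otimes>\<^sub>M N \<rightarrow>\<^sub>M K"
  shows "indep_vars (\<lambda>_. K) (\<lambda>i \<omega>. h (X i \<omega>) (V i \<omega>)) I"
proof -
  define J where "J i = {Inl i, Inr i}" for i :: 'b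
  have "indep_vars (\<lambda>i. PiM (J i) (\<lambda>_. N)) (\<lambda>i \<omega>. \<lambda>k\<in>J i. case_sum X V k \<omega>) I"
    by (rule indep_vars_restrict[OF indep]) (auto simp: J_def disjoint_family_on_def)
  moreover have "(\<lambda>f. h (f (Inl i)) (f (Inr i))) \<in> PiM (J i) (\<lambda>_. N) \<rightarrow>\<^sub>M K" for i
  proof -
    have "(\<lambda>f. (f (Inl i), f (Inr i))) \<in> PiM (J i) (\<lambda>_. N) \<rightarrow>\<^sub>M N \<Otimes>\<^sub>M N"
      by (intro measurable_Pair measurable_component_singleton) (auto simp: J_def)
    from measurable_compose[OF this h] show ?thesis by simp
  qed
  ultimately have "indep_vars (\<lambda>_. K) (\<lambda>i \<omega>. (\<lambda>f. h (f (Inl i)) (f (Inr i)))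
      (\<lambda>k\<in>J i. case_sum X V k \<omega>)) I"
    by (rule indep_vars_compose2)
  then show ?thesis by (simp add: J_def)
qed

theorem proposition2:
  fixes M :: "'a measure"
    and P :: "('p::{finite,linorder}) cvec measure"
    and x :: "'a \<Rightarrow> 'p cvec" and w :: "'p set \<Rightarrow> 'a \<Rightarrow> 'p \<Rightarrow> complex"
    and X V :: "nat \<Rightarrow> 'a \<Rightarrow> 'p cvec" and vt :: "'a \<Rightarrow> 'p cvec"
    and g :: "'p set \<Rightarrow> ('p \<Rightarrow> complex) \<Rightarrow> 'p cvec"
    and \<xi> :: "'p cvec \<Rightarrow> 'p cvec"
    and \<eta> :: "'p cvec \<Rightarrow> 'p cvec \<Rightarrow> real"
    and \<S> :: "'p set set" and c :: "'p set \<Rightarrow> real"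
    and \<Gamma> \<sigma> L \<delta> :: real and m :: nat
  assumes "prob_space M"
    and "prob_space P" and "sets P = sets borel"
    and "m \<ge> 1"
    \<comment> \<open>feasible set\<close>
    and "\<And>\<Omega>. c \<Omega> \<ge> 0" and "\<And>\<Omega>1 \<Omega>2. \<Omega>1 \<subseteq> \<Omega>2 \<Longrightarrow> c \<Omega>1 \<le> c \<Omega>2" and "\<Gamma> > 0"
    \<comment> \<open>measurability of the decoder, performance measure and denoiser\<close>
    and "\<And>\<Omega>. g \<Omega> \<in> Pi\<^sub>M \<Omega> (\<lambda>_. borel) \<rightarrow>\<^sub>M borel"
    and "(\<lambda>(y, y'). \<eta> y y') \<in> borel_measurable (borel \<Otimes>\<^sub>M borel)"
    and "\<xi> \<in> borel_measurable borel"
    \<comment> \<open>test signal and measurement noise\<close>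
    and "x \<in> borel_measurable M" and "distr M borel x = P"
    and "\<And>\<Omega>. \<Omega> \<in> feasible_patterns \<S> c \<Gamma> \<Longrightarrow>
           indep_pair M borel x (Pi\<^sub>M \<Omega> (\<lambda>_. borel)) (w \<Omega>)"
    and "\<And>\<Omega>. \<Omega> \<in> feasible_patterns \<S> c \<Gamma> \<Longrightarrow> iid_cscg M \<Omega> (\<sigma>\<^sup>2) (w \<Omega>)"
    \<comment> \<open>training signals and their noise, all mutually independent\<close>
    and "prob_space.indep_vars M (\<lambda>_. borel) (case_sum X V) ({1..m} <+> {1..m})"
    and "\<And>j. j \<in> {1..m} \<Longrightarrow> distr M borel (X j) = P"
    and "\<And>j. j \<in> {1..m} \<Longrightarrow> iid_cscg M UNIV (\<sigma>\<^sup>2) (\<lambda>\<omega> i. V j \<omega> $ i)"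
    \<comment> \<open>effective noise; the expectations of norms are compared in \<open>[0, \<infinity>]\<close>\<close>
    and "\<And>j. j \<in> {1..m} \<Longrightarrow>
           (\<integral>\<^sup>+\<omega>. ennreal (norm (effective_noise \<xi> (X j \<omega>) (V j \<omega>))) \<partial>M)
             \<le> (\<integral>\<^sup>+\<omega>. ennreal (norm (V j \<omega>)) \<partial>M)"
    and "vt \<in> borel_measurable M"
    and "\<And>j. j \<in> {1..m} \<Longrightarrow>
           distr M borel vt = distr M borel (\<lambda>\<omega>. effective_noise \<xi> (X j \<omega>) (V j \<omega>))"
    \<comment> \<open>performance measure\<close>
    and "\<And>y y'. 0 \<le> \<eta> y y' \<and> \<eta> y y' \<le> 1"
    and "L > 0" and "\<And>y y' z. \<bar>\<eta> y z - \<eta> y' z\<bar> \<le> L * norm (y - y')"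
    and "0 < \<delta>" and "\<delta> < 1"
  shows "1 - \<delta> \<le> \<P>(\<omega> in M. \<forall>\<Omega> \<in> feasible_patterns \<S> c \<Gamma>.
           \<bar>(1 / real m) * (\<Sum>j=1..m.
               \<eta> (X j \<omega> + effective_noise \<xi> (X j \<omega>) (V j \<omega>))
                 (g \<Omega> (subsample \<Omega> (fourier_matrix *v (X j \<omega> + V j \<omega>)))))
             - eta_noisy M \<eta> g x w \<Omega>\<bar>
           \<le> L * prob_space.expectation M (\<lambda>\<omega>. norm (vt \<omega>))
             + sqrt (1 / (2 * real m) * ln (2 * real (card (feasible_patterns \<S> c \<Gamma>)) / \<delta>)))"
proof -
  interpret prob_space M by fact
  let ?A = "feasible_patterns \<S> c \<Gamma>"
  let ?h = "\<lambda>\<Omega> a b. \<eta> (a + effective_noise \<xi> a b) (g \<Omega> (subsample \<Omega> (fourier_matrix *v (a + b))))"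
  let ?Y = "\<lambda>\<Omega> j \<omega>. ?h \<Omega> (X j \<omega>) (V j \<omega>)"
  let ?t = "sqrt (1 / (2 * real m) * ln (2 * real (card ?A) / \<delta>))"
  note g = assms(8) and \<eta> = assms(9) and \<xi> = assms(10) and XV = assms(15) and vt = assms(19,20)
    and range = assms(21) and lipschitz = assms(23)
  note [measurable] = g \<xi> \<open>vt \<in> borel_measurable M\<close> measurable_subsample
    borel_measurable_orthogonal_transformation[OF orthogonal_transformation_fourier_matrix]
  have XV_meas: "X j \<in> borel_measurable M" "V j \<in> borel_measurable M" if "j \<in> {1..m}" for j
  proof -
    have "case_sum X V k \<in> borel_measurable M" if "k \<in> {1..m} <+> {1..m}" for k
      using XV that by (simp add: indep_vars_def2)
    from this[OF InlI[OF that]] this[OF InrI[OF that]]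
    show "X j \<in> borel_measurable M" "V j \<in> borel_measurable M" by simp_all
  qed
  \<comment> \<open>For a fixed pattern every summand is one fixed measurable function of a signal
    and its noise; this gives independence over \<open>j\<close>.\<close>
  have h: "(\<lambda>(a, b). ?h \<Omega> a b) \<in> borel_measurable (borel \<Otimes>\<^sub>M borel)" for \<Omega>
    unfolding effective_noise_def case_prod_beta
    by (rule measurable_compose[OF measurable_Pair \<eta>, unfolded prod.case]) measurable
  have indep: "indep_vars (\<lambda>_. borel) (?Y \<Omega>) {1..m}" for \<Omega>
    by (rule indep_vars_case_sum[OF XV h])
  have bias: "\<bar>expectation (?Y \<Omega> j) - eta_noisy M \<eta> g x w \<Omega>\<bar> \<le> L * expectation (\<lambda>\<omega>. norm (vt \<omega>))"
    if \<Omega>: "\<Omega> \<in> ?A" and j: "j \<in> {1..m}" for \<Omega> j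
  proof -
    note [measurable] = XV_meas[OF j]
    have "indep_var borel (X j) borel (V j)"
      using indep_vars_imp_indep_var[OF XV, OF InlI[OF j] InrI[OF j]] by simp
    moreover have "distr M borel (X j) = distr M borel x"
      using assms(12) assms(16)[OF j] by simp
    ultimately have "\<bar>expectation (?Y \<Omega> j) - eta_noisy M \<eta> g x w \<Omega>\<bar>
        \<le> L * expectation (\<lambda>\<omega>. norm (effective_noise \<xi> (X j \<omega>) (V j \<omega>)))"
      using range lipschitz
      by (intro expectation_denoised_error[where s="\<sigma>\<^sup>2"] prob_space_axioms g \<eta> \<xi> assms(13)[OF \<Omega>]
          assms(14)[OF \<Omega>] assms(17)[OF j] assms(18)[OF j])
    \<comment> \<open>The mean norm depends only on the law of the effective noise, which is that of
      \<open>vt\<close> for every \<open>j\<close>. The bound on the bias is thus the same for all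
      training signals and survives averaging.\<close>
    also have "expectation (\<lambda>\<omega>. norm (effective_noise \<xi> (X j \<omega>) (V j \<omega>)))
        = (\<integral>z. norm z \<partial>distr M borel (\<lambda>\<omega>. effective_noise \<xi> (X j \<omega>) (V j \<omega>)))"
      unfolding effective_noise_def by (subst integral_distr) simp_all
    also have "\<dots> = expectation (\<lambda>\<omega>. norm (vt \<omega>))"
      unfolding vt(2)[OF j, symmetric] by (simp add: integral_distr)
    finally show ?thesis .
  qed
  have mean_bias: "\<bar>(\<Sum>j=1..m. expectation (?Y \<Omega> j)) / real m - eta_noisy M \<eta> g x w \<Omega>\<bar>
      \<le> L * expectation (\<lambda>\<omega>. norm (vt \<omega>))" if \<Omega>: "\<Omega> \<in> ?A" for \<Omega>
  proof -
    have "(\<Sum>j=1..m. expectation (?Y \<Omega> j)) / real m - eta_noisy M \<eta> g x w \<Omega>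
        = (\<Sum>j=1..m. expectation (?Y \<Omega> j) - eta_noisy M \<eta> g x w \<Omega>) / real m"
      using \<open>m \<ge> 1\<close> by (simp add: sum_subtractf field_simps)
    moreover have "\<bar>\<Sum>j=1..m. expectation (?Y \<Omega> j) - eta_noisy M \<eta> g x w \<Omega>\<bar>
        \<le> (\<Sum>j=1..m. L * expectation (\<lambda>\<omega>. norm (vt \<omega>)))"
      by (rule order_trans[OF sum_abs sum_mono[OF bias[OF \<Omega>]]])
    ultimately show ?thesis
      using \<open>m \<ge> 1\<close> by (simp add: field_simps)
  qed
  have "1 - \<delta> \<le> \<P>(\<omega> in M. \<forall>\<Omega>\<in>?A.
      \<bar>(\<Sum>j=1..m. ?Y \<Omega> j \<omega>) / real m - (\<Sum>j=1..m. expectation (?Y \<Omega> j)) / real m\<bar> \<le> ?t)"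
    using Hoeffding_ineq_uniform[of ?A "{1..m}" ?Y \<delta>] indep range \<open>m \<ge> 1\<close> \<open>0 < \<delta>\<close> \<open>\<delta> < 1\<close>
    by simp
  \<comment> \<open>By the triangle inequality through the mean of the average, small deviation and
    bounded bias together imply the claimed bound, so the events are nested.\<close>
  also have "\<dots> \<le> \<P>(\<omega> in M. \<forall>\<Omega>\<in>?A.
      \<bar>(1 / real m) * (\<Sum>j=1..m. ?Y \<Omega> j \<omega>) - eta_noisy M \<eta> g x w \<Omega>\<bar>
        \<le> L * expectation (\<lambda>\<omega>. norm (vt \<omega>)) + ?t)"
  proof (rule finite_measure_mono)
    show "{\<omega>\<in>space M. \<forall>\<Omega>\<in>?A.
        \<bar>(\<Sum>j=1..m. ?Y \<Omega> j \<omega>) / real m - (\<Sum>j=1..m. expectation (?Y \<Omega> j)) / real m\<bar> \<le> ?t}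
      \<subseteq> {\<omega>\<in>space M. \<forall>\<Omega>\<in>?A.
        \<bar>(1 / real m) * (\<Sum>j=1..m. ?Y \<Omega> j \<omega>) - eta_noisy M \<eta> g x w \<Omega>\<bar>
          \<le> L * expectation (\<lambda>\<omega>. norm (vt \<omega>)) + ?t}"
    proof safe
      fix \<omega> \<Omega> assume \<Omega>: "\<Omega> \<in> ?A" and "\<forall>\<Omega>\<in>?A.
        \<bar>(\<Sum>j=1..m. ?Y \<Omega> j \<omega>) / real m - (\<Sum>j=1..m. expectation (?Y \<Omega> j)) / real m\<bar> \<le> ?t"
      then have "\<bar>(\<Sum>j=1..m. ?Y \<Omega> j \<omega>) / real m - (\<Sum>j=1..m. expectation (?Y \<Omega> j)) / real m\<bar> \<le> ?t"
        by blast
      with mean_bias[OF \<Omega>]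
      show "\<bar>(1 / real m) * (\<Sum>j=1..m. ?Y \<Omega> j \<omega>) - eta_noisy M \<eta> g x w \<Omega>\<bar>
          \<le> L * expectation (\<lambda>\<omega>. norm (vt \<omega>)) + ?t"
        by simp
    qed
    have [measurable]: "?Y \<Omega> j \<in> borel_measurable M" if "j \<in> {1..m}" for \<Omega> j
      using indep that by (simp add: indep_vars_def2)
    \<comment> \<open>The patterns are subsets of a finite type, so the event is a finite
      intersection of measurable sets.\<close>
    have "finite ?A" by simp
    then show "{\<omega>\<in>space M. \<forall>\<Omega>\<in>?A.
        \<bar>(1 / real m) * (\<Sum>j=1..m. ?Y \<Omega> j \<omega>) - eta_noisy M \<eta> g x w \<Omega>\<bar>
          \<le> L * expectation (\<lambda>\<omega>. norm (vt \<omega>)) + ?t} \<in> events"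
      by measurable
  qed
  finally show ?thesis .
qed

end
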